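(* Let $r\ge2$ and let $H=K_r-e$ be the complete graph $K_r$ with one edge removed. Then for every graph $G$ with $n\ge1$ vertices, the independence polynomial $I(G\circ H;x)$ is symmetric and unimodal; moreover its mode is unique and equal to $n$.
   Context: All graphs are finite and simple. An independent set is a set of pairwise non-adjacent vertices; if $s_k$ is the number of independent sets of size $k$ in a graph $F$ and $\alpha(F)$ the largest size of an independent set, the independence polynomial is $I(F;x)=\sum_{k=0}^{\alpha(F)}s_kx^k$. The corona $G\circ H$ is the graph obtained from $G$ and $|V(G)|$ disjoint copies of $H$, one for each vertex of $G$, by joining each vertex of $G$ to all vertices of its copy of $H$. A polynomial $\sum_{k=0}^{N}a_kx^k$ of degree $N$ is symmetric if $a_i=a_{N-i}$ for all $i$, and unimodal if there is an index $k$ (a mode) with $a_0\le\cdots\le a_{k-1}\le a_k\ge a_{k+1}\ge\cdots\ge a_N$; the mode is unique if exactly one index has this property. *)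

theory Defs
  imports "Graph_Theory.Kuratowski" "HOL-Computational_Algebra.Polynomial"
begin

text \<open>Finite simple graphs are the \<^locale>\<open>pair_graph\<close>s of \<^theory>\<open>Graph_Theory.Pair_Digraph\<close>:
  finite, loop-free, symmetric digraphs without parallel arcs, an edge \<open>uv\<close> being the two
  arcs \<open>(u, v)\<close> and \<open>(v, u)\<close>.\<close>

definition independent_set :: "'a pair_pre_digraph \<Rightarrow> 'a set \<Rightarrow> bool" where
  "independent_set F S \<longleftrightarrow> S \<subseteq> pverts F \<and> pairwise (\<lambda>u v. (u, v) \<notin> parcs F) S"

definition num_independent_sets :: "'a pair_pre_digraph \<Rightarrow> nat \<Rightarrow> nat" where
  "num_independent_sets F k = card {S. independent_set F S \<and> card S = k}"

definition independence_number :: "'a pair_pre_digraph \<Rightarrow> nat" where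
  "independence_number F = Max (card ` {S. independent_set F S})"

definition independence_poly :: "'a pair_pre_digraph \<Rightarrow> int poly" where
  "independence_poly F =
     (\<Sum>k\<le>independence_number F. monom (int (num_independent_sets F k)) k)"

text \<open>The copy of \<open>H\<close> belonging to the vertex \<open>u\<close> of \<open>G\<close> has the vertices \<open>Inr (u, x)\<close>.\<close>

definition corona ::
  "'a pair_pre_digraph \<Rightarrow> 'b pair_pre_digraph \<Rightarrow> ('a + 'a \<times> 'b) pair_pre_digraph" where
  "corona G H =
     \<lparr> pverts = pverts G <+> (pverts G \<times> pverts H),
       parcs = {(Inl u, Inl v) | u v. (u, v) \<in> parcs G}
             \<union> {(Inr (u, x), Inr (u, y)) | u x y. u \<in> pverts G \<and> (x, y) \<in> parcs H}
             \<union> {(Inl u, Inr (u, x)) | u x. u \<in> pverts G \<and> x \<in> pverts H}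
             \<union> {(Inr (u, x), Inl u) | u x. u \<in> pverts G \<and> x \<in> pverts H} \<rparr>"

definition delete_edge :: "'a pair_pre_digraph \<Rightarrow> 'a \<Rightarrow> 'a \<Rightarrow> 'a pair_pre_digraph" where
  "delete_edge F u v = F\<lparr>parcs := parcs F - {(u, v), (v, u)}\<rparr>"

text \<open>\<open>K\<^sub>r - e\<close> is only determined up to isomorphism, hence a predicate on graphs.\<close>

definition complete_minus_edge :: "nat \<Rightarrow> 'a pair_pre_digraph \<Rightarrow> bool" where
  "complete_minus_edge r H \<longleftrightarrow>
     (\<exists>F u v. K\<^bsub>r\<^esub> (with_proj F) \<and> (u, v) \<in> parcs F \<and> H = delete_edge F u v)"

definition symmetric_poly :: "'a::zero poly \<Rightarrow> bool" where
  "symmetric_poly p \<longleftrightarrow> (\<forall>i\<le>degree p. coeff p i = coeff p (degree p - i))"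

definition is_mode :: "'a::{zero,linorder} poly \<Rightarrow> nat \<Rightarrow> bool" where
  "is_mode p k \<longleftrightarrow> k \<le> degree p \<and>
     (\<forall>i<k. coeff p i \<le> coeff p (Suc i)) \<and>
     (\<forall>i. k \<le> i \<and> i < degree p \<longrightarrow> coeff p (Suc i) \<le> coeff p i)"

definition unimodal_poly :: "'a::{zero,linorder} poly \<Rightarrow> bool" where
  "unimodal_poly p \<longleftrightarrow> (\<exists>k. is_mode p k)"

lemma pair_graph_corona:
  assumes "pair_graph G" and "pair_graph H"
  shows "pair_graph (corona G H)"
proof -
  interpret G: pair_graph G by fact
  interpret H: pair_graph H by fact
  let ?V = "pverts G <+> (pverts G \<times> pverts H)"
  have sub: "parcs (corona G H) \<subseteq> ?V \<times> ?V"
    by (auto simp: corona_def dest: G.wellformed' H.wellformed')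
  moreover have fin: "finite ?V"
    by (simp add: G.pair_finite_verts H.pair_finite_verts)
  ultimately have finp: "finite (parcs (corona G H))"
    by (meson finite_SigmaI finite_subset)
  have V: "pverts (corona G H) = ?V" by (simp add: corona_def)
  have S: "sym (parcs (corona G H))"
    by (rule symI) (auto simp: corona_def dest: G.arcs_symmetric H.arcs_symmetric)
  have L: "fst e \<noteq> snd e" if "e \<in> parcs (corona G H)" for e
    using that by (auto simp: corona_def dest: G.no_loops' H.no_loops')
  show ?thesis
    using sub fin finp S L by unfold_locales (auto simp: V symmetric_def)
qed

lemma pair_graph_complete_minus_edge:
  assumes "complete_minus_edge r H"
  shows "pair_graph H" and "card (pverts H) = r"
proof -
  obtain F u v where F: "finite (pverts F)" "card (pverts F) = r"
    "parcs F = {(u, v). (u, v) \<in> pverts F \<times> pverts F \<and> u \<noteq> v}" and H: "H = delete_edge F u v"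
    using assms unfolding complete_minus_edge_def complete_digraph_pair_def by blast
  have "finite (parcs F)"
    by (rule finite_subset[of _ "pverts F \<times> pverts F"]) (auto simp: F)
  then show "pair_graph H"
    by unfold_locales (auto simp: H delete_edge_def symmetric_def F intro!: symI)
  show "card (pverts H) = r" by (simp add: H delete_edge_def F)
qed

end

theory Submission
  imports Defs
begin

text \<open>Sorting the independent sets of \<open>G \<circ> H\<close> by their trace \<open>S\<close> on \<open>G\<close> gives
  \<open>I(G \<circ> H; x) = \<Sum>\<^sub>S x\<^bsup>|S|\<^esup> I(H; x)\<^bsup>n - |S|\<^esup>\<close>. Since \<open>I(K\<^sub>r - e; x) = (1 + x)\<^sup>2 + (r - 2) x\<close>,
  every summand expands with nonnegative coefficients in the polynomials
  \<open>x\<^sup>j (1 + x)\<^bsup>2 (n - j)\<^esup>\<close>, all of which are symmetric about \<open>n\<close> and unimodal. Strictness, and with it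
  uniqueness of the mode, comes from the term \<open>(1 + x)\<^bsup>2 n\<^esup>\<close> contributed by \<open>S = {}\<close>.\<close>

section \<open>Palindromic polynomials that increase up to the center\<close>

text \<open>The center \<open>n\<close> is fixed independently of the degree, which is only bounded
  by \<open>2 * n\<close>: summands of different degrees then share one center and the class is
  closed under addition. Only the left half is constrained; symmetry settles the right half.\<close>

definition palindromic_mono :: "nat \<Rightarrow> 'a::linordered_idom poly \<Rightarrow> bool" where
  "palindromic_mono n p \<longleftrightarrow> degree p \<le> 2 * n \<and>
     (\<forall>i\<le>2 * n. coeff p (2 * n - i) = coeff p i) \<and>
     0 \<le> coeff p 0 \<and> (\<forall>i<n. coeff p i \<le> coeff p (Suc i))"

text \<open>By symmetry the positive constant coefficient reappears at \<open>2 * n\<close>, so the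
  degree is exactly \<open>2 * n\<close>. One strict summand is enough to make a sum of palindromic
  summands strict.\<close>

definition palindromic_strict_mono :: "nat \<Rightarrow> 'a::linordered_idom poly \<Rightarrow> bool" where
  "palindromic_strict_mono n p \<longleftrightarrow> palindromic_mono n p \<and>
     0 < coeff p 0 \<and> (\<forall>i<n. coeff p i < coeff p (Suc i))"

lemma palindromic_mono_0: "palindromic_mono n 0"
  by (simp add: palindromic_mono_def)

lemma palindromic_mono_add:
  "palindromic_mono n p \<Longrightarrow> palindromic_mono n q \<Longrightarrow> palindromic_mono n (p + q)"
  by (auto simp: palindromic_mono_def degree_add_le intro: add_mono)

lemma palindromic_mono_sum:
  "(\<And>x. x \<in> A \<Longrightarrow> palindromic_mono n (f x)) \<Longrightarrow> palindromic_mono n (sum f A)"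
  by (induction A rule: infinite_finite_induct)
    (auto intro: palindromic_mono_0 palindromic_mono_add)

lemma palindromic_mono_smult:
  "0 \<le> c \<Longrightarrow> palindromic_mono n p \<Longrightarrow> palindromic_mono n (smult c p)"
  by (auto simp: palindromic_mono_def intro: mult_left_mono order.trans[OF degree_smult_le])

lemma palindromic_strict_mono_add:
  "palindromic_strict_mono n p \<Longrightarrow> palindromic_mono n q \<Longrightarrow> palindromic_strict_mono n (p + q)"
  by (auto simp: palindromic_strict_mono_def palindromic_mono_add)
    (auto simp: palindromic_mono_def intro: add_pos_nonneg add_less_le_mono)

lemma palindromic_strict_mono_sum:
  assumes "finite A" "a \<in> A" "palindromic_strict_mono n (f a)"
    and "\<And>x. x \<in> A - {a} \<Longrightarrow> palindromic_mono n (f x)"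
  shows "palindromic_strict_mono n (sum f A)"
  unfolding sum.remove[OF assms(1,2)]
  using assms by (intro palindromic_strict_mono_add palindromic_mono_sum)

section \<open>The gamma basis and the expansion of trinomial powers in it\<close>

lemma coeff_monom_mult_linear_power:
  "coeff (monom 1 j * [:1, 1:] ^ m) i =
     (if i < j then 0 else of_nat (m choose (i - j)) :: 'a::linordered_idom)"
  by (cases "i - j \<le> m")
    (simp_all add: coeff_monom_mult coeff_linear_poly_power coeff_eq_0 degree_linear_power)

text \<open>The coefficients are row \<open>2 * (n - j)\<close> of Pascal's triangle shifted by
  \<open>j\<close>, so the middle of the row sits at (n - j) + j = n. Symmetry and growth are those
  of the row.\<close>

lemma palindromic_mono_gamma_basis:
  assumes "j \<le> n"
  shows "palindromic_mono n (monom 1 j * [:1, 1:] ^ (2 * (n - j)) :: 'a::linordered_idom poly)"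
proof -
  let ?p = "monom 1 j * [:1, 1:] ^ (2 * (n - j)) :: 'a poly"
  have "degree ?p \<le> 2 * n"
  proof (rule degree_le, intro allI impI)
    fix i assume "2 * n < i"
    then show "coeff ?p i = 0"
      using assms by (simp add: coeff_monom_mult_linear_power)
  qed
  moreover have "coeff ?p (2 * n - i) = coeff ?p i" if "i \<le> 2 * n" for i
  \<comment> \<open>The reflection \<open>i\<close> to \<open>2 * n - i\<close> preserves the window
    from \<open>j\<close> to \<open>2 * n - j\<close>; outside it both coefficients are
    zero.\<close>
  proof (cases "j \<le> i \<and> i \<le> 2 * n - j")
    case True
    then have idx: "2 * n - i - j = 2 * (n - j) - (i - j)" "i - j \<le> 2 * (n - j)"
      "\<not> 2 * n - i < j"
      using assms by linarith+
    have "coeff ?p (2 * n - i) = of_nat (2 * (n - j) choose (2 * (n - j) - (i - j)))"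
      unfolding coeff_monom_mult_linear_power idx(1) using idx(3) by simp
    also have "\<dots> = of_nat (2 * (n - j) choose (i - j))"
      by (simp only: binomial_symmetric[OF idx(2), symmetric])
    also have "\<dots> = coeff ?p i"
      unfolding coeff_monom_mult_linear_power using True by simp
    finally show ?thesis .
  next
    case False
    then show ?thesis
      using that assms by (auto simp: coeff_monom_mult_linear_power)
  qed
  moreover have "coeff ?p i \<le> coeff ?p (Suc i)" if "i < n" for i
  proof (cases "i < j")
    case False
    \<comment> \<open>Since \<open>i < n\<close>, the index \<open>Suc i - j\<close> is at most
      \<open>n - j\<close>, so both entries lie in the left half of the row.\<close>
    have "2 * (n - j) choose (i - j) \<le> 2 * (n - j) choose (Suc i - j)"
      by (rule binomial_mono) (use False that in auto)
    then show ?thesis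
      using False by (simp add: coeff_monom_mult_linear_power)
  qed (simp add: coeff_monom_mult_linear_power)
  ultimately show ?thesis
    by (simp add: palindromic_mono_def coeff_monom_mult_linear_power)
qed

lemma palindromic_strict_mono_linear_power:
  "palindromic_strict_mono n ([:1, 1:] ^ (2 * n) :: 'a::linordered_idom poly)"
proof -
  have "2 * n choose i < 2 * n choose Suc i" if "i < n" for i
    by (rule binomial_strict_mono) (use that in auto)
  then show ?thesis
    using palindromic_mono_gamma_basis[of 0 n, where 'a='a]
    by (simp add: palindromic_strict_mono_def coeff_linear_poly_power)
qed

text \<open>This is the gamma expansion: apply the binomial theorem to 1 + c x + x^2 = (c - 2) x +
  (1 + x)^2. The factor x^k merely moves the basis index from \<open>j\<close> to
  \<open>j + k\<close> without changing the center. The coefficients are nonnegative once c \<ge>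
  2.\<close>

lemma monom_mult_trinomial_power_eq:
  fixes c :: "'a::comm_ring_1"
  assumes "k \<le> n"
  shows "monom 1 k * [:1, c, 1:] ^ (n - k) =
    (\<Sum>j\<le>n - k. smult (of_nat (n - k choose j) * (c - 2) ^ j)
       (monom 1 (j + k) * [:1, 1:] ^ (2 * (n - (j + k)))))"
proof -
  have "[:1, c, 1:] = monom (c - 2) 1 + [:1, 1:]\<^sup>2"
    by (simp add: power2_eq_square monom_altdef)
  then have "monom 1 k * [:1, c, 1:] ^ (n - k) =
    (\<Sum>j\<le>n - k. monom 1 k * (of_nat (n - k choose j) * monom (c - 2) 1 ^ j *
       ([:1, 1:]\<^sup>2) ^ (n - k - j)))"
    by (simp only: binomial_ring sum_distrib_left)
  also have "\<dots> = (\<Sum>j\<le>n - k. smult (of_nat (n - k choose j) * (c - 2) ^ j)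
       (monom 1 (j + k) * [:1, 1:] ^ (2 * (n - (j + k)))))"
  proof (rule sum.cong)
    fix j
    have "monom 1 k * (of_nat m * monom (c - 2) 1 ^ j) = smult (of_nat m * (c - 2) ^ j) (monom 1 (j + k))"
      for m :: nat
      by (simp add: monom_power of_nat_poly mult_monom smult_monom add.commute)
    then show "monom 1 k * (of_nat (n - k choose j) * monom (c - 2) 1 ^ j *
       ([:1, 1:]\<^sup>2) ^ (n - k - j)) = smult (of_nat (n - k choose j) * (c - 2) ^ j)
       (monom 1 (j + k) * [:1, 1:] ^ (2 * (n - (j + k))))"
      by (simp only: mult.assoc[symmetric] mult_smult_left power_mult diff_diff_left add.commute)
  qed simp
  finally show ?thesis .
qed

lemma palindromic_mono_monom_mult_trinomial_power:
  fixes c :: "'a::linordered_idom"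
  assumes "k \<le> n" "2 \<le> c"
  shows "palindromic_mono n (monom 1 k * [:1, c, 1:] ^ (n - k))"
  unfolding monom_mult_trinomial_power_eq[OF assms(1)] using assms
  by (auto intro!: palindromic_mono_sum palindromic_mono_smult palindromic_mono_gamma_basis)

lemma palindromic_strict_mono_trinomial_power:
  fixes c :: "'a::linordered_idom"
  assumes "2 \<le> c"
  shows "palindromic_strict_mono n ([:1, c, 1:] ^ n)"
proof -
  have "palindromic_strict_mono n (\<Sum>j\<le>n. smult (of_nat (n choose j) * (c - 2) ^ j)
       (monom 1 j * [:1, 1:] ^ (2 * (n - j))))"
    \<comment> \<open>The summand \<open>j = 0\<close> is (1 + x)^(2n) with coefficient 1, which is
      strict.\<close>
    by (rule palindromic_strict_mono_sum[where a = 0])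
      (use assms in \<open>auto intro!: palindromic_mono_smult palindromic_mono_gamma_basis
        palindromic_strict_mono_linear_power\<close>)
  then show ?thesis
    using monom_mult_trinomial_power_eq[of 0 n c] by simp
qed

section \<open>From strict palindromic growth to symmetry and a unique mode\<close>

lemma palindromic_strict_mono_imp:
  fixes p :: "'a::linordered_idom poly"
  assumes "palindromic_strict_mono n p"
  shows "symmetric_poly p" and "is_mode p k \<longleftrightarrow> k = n"
proof -
  have deg: "degree p \<le> 2 * n" and sym: "\<And>i. i \<le> 2 * n \<Longrightarrow> coeff p (2 * n - i) = coeff p i"
    and pos: "0 < coeff p 0" and incr: "\<And>i. i < n \<Longrightarrow> coeff p i < coeff p (Suc i)"
    using assms by (auto simp: palindromic_strict_mono_def palindromic_mono_def)
  have "coeff p (2 * n) \<noteq> 0"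
    using sym[of 0] pos by simp
  then have deg: "degree p = 2 * n"
    using deg le_degree by (metis order.antisym)
  show "symmetric_poly p"
    by (simp add: symmetric_poly_def deg sym)
  have decr: "coeff p (Suc i) < coeff p i" if "n \<le> i" "i < 2 * n" for i
  proof -
    \<comment> \<open>The reflection turns the step from \<open>i\<close> to \<open>Suc i\<close>
      into the step from \<open>2 * n - Suc i\<close> to \<open>2 * n - i\<close>, which lies in the
      increasing half because \<open>n \<le> i\<close>.\<close>
    have "Suc (2 * n - Suc i) = 2 * n - i"
      using that by simp
    then show ?thesis
      using incr[of "2 * n - Suc i"] sym[of i] sym[of "Suc i"] that by simp
  qed
  show "is_mode p k \<longleftrightarrow> k = n"
  proof
    assume k: "is_mode p k"
    \<comment> \<open>A mode below \<open>n\<close> would forbid the rise from \<open>k\<close> to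
      \<open>Suc k\<close>; a mode above \<open>n\<close> would forbid the fall from
      \<open>n\<close> to \<open>Suc n\<close>.\<close>
    have "\<not> k < n"
      using k incr[of k] by (auto simp: is_mode_def deg dest!: spec[of _ k])
    moreover have "\<not> n < k"
      using k decr[of n] by (force simp: is_mode_def deg)
    ultimately show "k = n" by simp
  next
    assume "k = n"
    then show "is_mode p k"
      using incr decr by (auto simp: is_mode_def deg less_imp_le)
  qed
qed

section \<open>Independence polynomials\<close>

lemma finite_independent_sets: "finite (pverts F) \<Longrightarrow> finite {S. independent_set F S}"
  by (rule finite_subset[of _ "Pow (pverts F)"]) (auto simp: independent_set_def)

lemma independent_set_empty: "independent_set F {}"
  by (simp add: independent_set_def)

text \<open>Grouping the independent sets by size recovers the coefficients. The form as a sum over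
  sets can be reindexed along bijections.\<close>

lemma independence_poly_eq_sum:
  assumes "finite (pverts F)"
  shows "independence_poly F = (\<Sum>S | independent_set F S. monom 1 (card S))"
proof -
  let ?I = "{S. independent_set F S}"
  have fin: "finite ?I"
    using assms by (rule finite_independent_sets)
  have "(\<Sum>S\<in>?I. monom (1::int) (card S)) =
      (\<Sum>k\<le>independence_number F. \<Sum>S\<in>{S \<in> ?I. card S = k}. monom 1 (card S))"
    by (rule sum.group[symmetric]) (use fin in \<open>auto simp: independence_number_def\<close>)
  also have "\<dots> = independence_poly F"
    by (simp add: independence_poly_def num_independent_sets_def of_nat_poly smult_monom)
  finally show ?thesis by simp
qed

section \<open>Independent sets and independence polynomial of a corona\<close>

lemma independent_set_corona_iff:
  assumes "T \<subseteq> pverts G <+> (pverts G \<times> pverts H)"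
  shows "independent_set (corona G H) T \<longleftrightarrow>
    independent_set G {u. Inl u \<in> T} \<and>
    (\<forall>u\<in>pverts G. independent_set H {x. Inr (u, x) \<in> T}) \<and>
    (\<forall>u x. Inl u \<in> T \<longrightarrow> Inr (u, x) \<notin> T)"
proof -
  have T: "u \<in> pverts G" if "Inl u \<in> T" for u
    using assms that by blast
  have T': "u \<in> pverts G \<and> x \<in> pverts H" if "Inr (u, x) \<in> T" for u x
    using assms that by blast
  show ?thesis
    using assms unfolding independent_set_def corona_def pairwise_def Ball_def
    by (simp add: split_sum_all) (auto dest: T T')
qed

text \<open>An independent set of the corona is its trace \<open>S\<close> on \<open>G\<close>
  together with a free choice of an independent set of \<open>H\<close> in each copy at a vertex
  outside \<open>S\<close>; the copies at \<open>S\<close> must stay empty. Extensional functions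
  make the choice \<open>f\<close> unique.\<close>

lemma bij_betw_independent_sets_corona:
  "bij_betw (\<lambda>(S, f). S <+> Sigma (pverts G - S) f)
     (SIGMA S : {S. independent_set G S}. pverts G - S \<rightarrow>\<^sub>E {T. independent_set H T})
     {T. independent_set (corona G H) T}"
proof -
  let ?A = "SIGMA S : {S. independent_set G S}. pverts G - S \<rightarrow>\<^sub>E {T. independent_set H T}"
  \<comment> \<open>The inverse reads off the trace and the slices; restricting to vertices outside
    the trace makes the second component extensional.\<close>
  let ?g = "\<lambda>T. ({u. Inl u \<in> T}, \<lambda>u\<in>pverts G - {u. Inl u \<in> T}. {x. Inr (u, x) \<in> T})"
  have 1: "?g (S <+> Sigma (pverts G - S) f) = (S, f)" if "(S, f) \<in> ?A" for S f
  proof -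
    have "{u. Inl u \<in> S <+> Sigma (pverts G - S) f} = S" by auto
    moreover have "(\<lambda>u\<in>pverts G - S. {x. Inr (u, x) \<in> S <+> Sigma (pverts G - S) f}) = f"
      using that by (intro extensionalityI[OF restrict_extensional]) (auto simp: PiE_def)
    ultimately show ?thesis by simp
  qed
  have 2: "independent_set (corona G H) (S <+> Sigma (pverts G - S) f)" if "(S, f) \<in> ?A" for S f
  proof (subst independent_set_corona_iff)
    have "S \<subseteq> pverts G" "\<And>u. u \<in> pverts G - S \<Longrightarrow> f u \<subseteq> pverts H"
      using that by (auto simp: independent_set_def dest!: PiE_mem)
    then show "S <+> Sigma (pverts G - S) f \<subseteq> pverts G <+> pverts G \<times> pverts H"
      by fastforce
    have "independent_set H {x. Inr (u, x) \<in> S <+> Sigma (pverts G - S) f}" if "u \<in> pverts G" for u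
    proof -
      have "{x. Inr (u, x) \<in> S <+> Sigma (pverts G - S) f} = (if u \<in> S then {} else f u)"
        using that by auto
      then show ?thesis
        using \<open>(S, f) \<in> ?A\<close> that by (auto simp: independent_set_empty dest!: PiE_mem)
    qed
    moreover have "{u. Inl u \<in> S <+> Sigma (pverts G - S) f} = S" by auto
    ultimately show "independent_set G {u. Inl u \<in> S <+> Sigma (pverts G - S) f} \<and>
      (\<forall>u\<in>pverts G. independent_set H {x. Inr (u, x) \<in> S <+> Sigma (pverts G - S) f}) \<and>
      (\<forall>u x. Inl u \<in> S <+> Sigma (pverts G - S) f \<longrightarrow> Inr (u, x) \<notin> S <+> Sigma (pverts G - S) f)"
      using that by auto
  qed
  have 3: "?g T \<in> ?A" "(case ?g T of (S, f) \<Rightarrow> S <+> Sigma (pverts G - S) f) = T"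
    if "independent_set (corona G H) T" for T
  proof -
    have T: "T \<subseteq> pverts G <+> (pverts G \<times> pverts H)"
      using that by (simp add: independent_set_def corona_def)
    note ind = that[unfolded independent_set_corona_iff[OF T]]
    show "?g T \<in> ?A"
      using ind by auto
    show "(case ?g T of (S, f) \<Rightarrow> S <+> Sigma (pverts G - S) f) = T"
    proof (rule set_eqI)
      fix p
      show "p \<in> (case ?g T of (S, f) \<Rightarrow> S <+> Sigma (pverts G - S) f) \<longleftrightarrow> p \<in> T"
        using ind T by (cases p) (auto split: if_splits)
    qed
  qed
  show ?thesis
  proof (rule bij_betw_byWitness[where f' = ?g])
    show "\<forall>p\<in>?A. ?g (case p of (S, f) \<Rightarrow> S <+> Sigma (pverts G - S) f) = p"
    proof
      fix p assume "p \<in> ?A"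
      then show "?g (case p of (S, f) \<Rightarrow> S <+> Sigma (pverts G - S) f) = p"
        by (cases p) (simp only: prod.case 1)
    qed
    show "(\<lambda>(S, f). S <+> Sigma (pverts G - S) f) ` ?A \<subseteq> {T. independent_set (corona G H) T}"
      using 2 by auto
    show "?g ` {T. independent_set (corona G H) T} \<subseteq> ?A"
      using 3(1) by blast
    show "\<forall>T\<in>{T. independent_set (corona G H) T}.
        (case ?g T of (S, f) \<Rightarrow> S <+> Sigma (pverts G - S) f) = T"
      by (intro ballI 3(2)) simp
  qed
qed

lemma independence_poly_corona:
  assumes "finite (pverts G)" "finite (pverts H)"
  shows "independence_poly (corona G H) =
    (\<Sum>S | independent_set G S.
       monom 1 (card S) * independence_poly H ^ (card (pverts G) - card S))"
proof -
  let ?V = "pverts G" and ?IG = "{S. independent_set G S}" and ?IH = "{T. independent_set H T}"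
  have "independence_poly (corona G H) =
      (\<Sum>(S, f) \<in> (SIGMA S : ?IG. ?V - S \<rightarrow>\<^sub>E ?IH). monom 1 (card (S <+> Sigma (?V - S) f)))"
  proof (subst independence_poly_eq_sum)
    show "finite (pverts (corona G H))"
      using assms by (simp add: corona_def)
  qed (simp add: case_prod_beta flip: sum.reindex_bij_betw[OF bij_betw_independent_sets_corona])
  also have "\<dots> = (\<Sum>S\<in>?IG. \<Sum>f\<in>?V - S \<rightarrow>\<^sub>E ?IH. monom 1 (card (S <+> Sigma (?V - S) f)))"
    using assms by (intro sum.Sigma[symmetric]) (auto simp: finite_independent_sets finite_PiE)
  also have "\<dots> = (\<Sum>S\<in>?IG. monom 1 (card S) * independence_poly H ^ (card ?V - card S))"
  proof (rule sum.cong)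
    fix S assume "S \<in> ?IG"
    then have S: "S \<subseteq> ?V" "finite S"
      using assms by (auto simp: independent_set_def finite_subset)
    \<comment> \<open>Sizes add up over \<open>S\<close> and the chosen sets, so the monomial
      factors over the vertices outside \<open>S\<close>.\<close>
    have "monom 1 (card (S <+> Sigma (?V - S) f)) = 
        monom (1::int) (card S) * (\<Prod>v\<in>?V - S. monom 1 (card (f v)))" if "f \<in> ?V - S \<rightarrow>\<^sub>E ?IH" for f
    proof -
      have "finite (f v)" if "v \<in> ?V - S" for v
        using \<open>f \<in> _\<close> that assms by (auto simp: independent_set_def finite_subset dest!: PiE_mem)
      then have "card (S <+> Sigma (?V - S) f) = card S + (\<Sum>v\<in>?V - S. card (f v))"
        using S assms by (subst card_Plus) auto
      then show ?thesis
        by (simp add: monom_altdef power_add power_sum)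
    qed
    then have "(\<Sum>f\<in>?V - S \<rightarrow>\<^sub>E ?IH. monom (1::int) (card (S <+> Sigma (?V - S) f))) =
        monom 1 (card S) * (\<Sum>f\<in>?V - S \<rightarrow>\<^sub>E ?IH. \<Prod>v\<in>?V - S. monom 1 (card (f v)))"
      by (simp add: sum_distrib_left)
    \<comment> \<open>Distributivity: summing a product over all choice functions gives the product
      of the sums, one factor \<open>independence_poly H\<close> per vertex outside
      \<open>S\<close>.\<close>
    also have "(\<Sum>f\<in>?V - S \<rightarrow>\<^sub>E ?IH. \<Prod>v\<in>?V - S. monom (1::int) (card (f v))) =
        (\<Prod>v\<in>?V - S. independence_poly H)"
      unfolding independence_poly_eq_sum[OF assms(2)] using assms
      by (intro prod_sum_PiE[symmetric]) (auto simp: finite_independent_sets)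
    finally show "(\<Sum>f\<in>?V - S \<rightarrow>\<^sub>E ?IH. monom (1::int) (card (S <+> Sigma (?V - S) f))) =
        monom 1 (card S) * independence_poly H ^ (card ?V - card S)"
      using S by (simp add: card_Diff_subset)
  qed simp
  finally show ?thesis .
qed

section \<open>The independence polynomial of K_r - e\<close>

lemma independence_poly_complete_minus_edge:
  assumes "complete_minus_edge r H"
  shows "independence_poly H = [:1, int r, 1:]"
proof -
  obtain F u v where F: "finite (pverts F)" "card (pverts F) = r"
    "parcs F = {(u, v). (u, v) \<in> pverts F \<times> pverts F \<and> u \<noteq> v}" and uv: "(u, v) \<in> parcs F"
    and H: "H = delete_edge F u v"
    using assms unfolding complete_minus_edge_def complete_digraph_pair_def by blast
  have pverts_H: "pverts H = pverts F"
    by (simp add: H delete_edge_def)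
  have uv: "u \<in> pverts F" "v \<in> pverts F" "u \<noteq> v"
    using uv F by auto
  have "independent_set H S \<longleftrightarrow> S = {} \<or> S \<in> (\<lambda>x. {x}) ` pverts F \<or> S = {u, v}" for S
  proof
    assume S: "independent_set H S"
    show "S = {} \<or> S \<in> (\<lambda>x. {x}) ` pverts F \<or> S = {u, v}"
    proof (cases "\<exists>x\<in>S. \<exists>y\<in>S. x \<noteq> y")
      case True
      then obtain x y where xy: "x \<in> S" "y \<in> S" "x \<noteq> y" by blast
      \<comment> \<open>The only distinct non-adjacent vertices are the ends of the deleted
        edge.\<close>
      have pair: "{a, b} = {u, v}" if "a \<in> S" "b \<in> S" "a \<noteq> b" for a b
        using that S by (auto simp: independent_set_def H delete_edge_def F pairwise_def)
      have "S \<subseteq> {u, v}"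
        using pair xy by blast
      then show ?thesis
        using pair[OF xy] xy by blast
    next
      case False
      then have "S = {} \<or> (\<exists>x. S = {x})" by blast
      then show ?thesis
        using S by (auto simp: independent_set_def H delete_edge_def)
    qed
  qed (use uv in \<open>auto simp: independent_set_def H delete_edge_def pairwise_def\<close>)
  then have "{S. independent_set H S} = insert {} (insert {u, v} ((\<lambda>x. {x}) ` pverts F))"
    by auto
  then have "independence_poly H = (\<Sum>S\<in>insert {} (insert {u, v} ((\<lambda>x. {x}) ` pverts F)). monom 1 (card S))"
    using independence_poly_eq_sum[of H] F(1) by (simp only: pverts_H)
  also have "\<dots> = monom 1 0 + (monom 1 2 + (\<Sum>S\<in>(\<lambda>x. {x}) ` pverts F. monom 1 (card S)))"
  \<comment> \<open>Since \<open>u \<noteq> v\<close>, the pair is not a singleton, so the three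
    kinds of sets contribute separately.\<close>
  proof -
    have "{u, v} \<notin> (\<lambda>x. {x}) ` pverts F"
      using uv(3) by auto
    then show ?thesis
      using F(1) uv(3) by (subst sum.insert; auto simp: numeral_2_eq_2)+
  qed
  also have "(\<Sum>S\<in>(\<lambda>x. {x}) ` pverts F. monom (1::int) (card S)) = monom (int r) 1"
    by (subst sum.reindex) (simp_all add: F(2) of_nat_poly smult_monom)
  also have "monom 1 0 + (monom 1 2 + monom (int r) 1) = [:1, int r, 1:]"
    by (simp add: monom_altdef power2_eq_square)
  finally show ?thesis .
qed

theorem theorem2p9:
  fixes G :: "'a pair_pre_digraph" and H :: "'b pair_pre_digraph" and r n :: nat
  assumes "r \<ge> 2" and "complete_minus_edge r H"
    and "pair_graph G" and "card (pverts G) = n" and "n \<ge> 1"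
  shows "symmetric_poly (independence_poly (corona G H)) \<and>
         unimodal_poly (independence_poly (corona G H)) \<and>
         (\<exists>!k. is_mode (independence_poly (corona G H)) k) \<and>
         is_mode (independence_poly (corona G H)) n"
proof -
  interpret G: pair_graph G by fact
  interpret H: pair_graph H using assms(2) by (rule pair_graph_complete_minus_edge)
  have "palindromic_strict_mono n (\<Sum>S | independent_set G S.
      monom 1 (card S) * [:1, int r, 1:] ^ (n - card S))"
  \<comment> \<open>The empty trace contributes the full power \<open>[:1, int r, 1:] ^ n\<close>,
    which is strict because \<open>r \<ge> 2\<close>; every other trace needs only the weak
    property.\<close>
  proof (rule palindromic_strict_mono_sum[where a = "{}"])
    fix S assume "S \<in> {S. independent_set G S} - {{}}"
    then have "card S \<le> n"
      using assms by (auto simp: independent_set_def intro: card_mono)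
    then show "palindromic_mono n (monom 1 (card S) * [:1, int r, 1:] ^ (n - card S))"
      using assms by (intro palindromic_mono_monom_mult_trinomial_power) auto
  qed (use assms in \<open>auto simp: finite_independent_sets independent_set_empty
      intro: palindromic_strict_mono_trinomial_power\<close>)
  then have "palindromic_strict_mono n (independence_poly (corona G H))"
    using assms by (simp add: independence_poly_corona independence_poly_complete_minus_edge)
  then show ?thesis
    using palindromic_strict_mono_imp[of n "independence_poly (corona G H)"]
    by (simp add: unimodal_poly_def)
qed

end
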